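(* Let $\phi,\psi:A\to L\{\tau\}$ be two rank $r$ Drinfeld $A$-modules over the finite $A$-field $L$ defined by $$\phi_T=\gamma(T)+g_1\tau+\cdots+g_r\tau^r\quad\text{and}\quad\psi_T=\gamma(T)+g_1'\tau+\cdots+g_r'\tau^r.$$ The following are equivalent: (i) $\phi$ and $\psi$ are isomorphic over $L$; (ii) $\phi$ and $\psi$ are isomorphic over $L^{sep}$ and there exists $\lambda\in B$ with $FI_\lambda(\phi)=FI_\lambda(\psi)$; (iii) $\phi$ and $\psi$ are isomorphic over $L^{sep}$ and $FI(\phi)=FI(\psi)$.
   Context: $A=\mathbb{F}_q[T]$; $L$ is a finite $A$-field, i.e. a finite field with an $\mathbb{F}_q$-algebra homomorphism $\gamma:A\to L$; $L^{sep}$ is a separable closure of $L$. $L\{\tau\}$ is the ring of $\mathbb{F}_q$-linear polynomials over $L$ under composition, where $\tau(x)=x^q$ (so $\tau a=a^q\tau$ for $a\in L$). A Drinfeld $A$-module of rank $r$ over $L$ is an $\mathbb{F}_q$-algebra homomorphism $\phi:A\to L\{\tau\}$, determined by $\phi_T=\gamma(T)+g_1\tau+\cdots+g_r\tau^r$ with $g_i\in L$, $g_r\ne0$. For a field $K\supseteq L$, $\phi$ and $\psi$ are isomorphic over $K$ if there is $x\in K^*$ with $\psi_T=x^{-1}\phi_Tx$, i.e. $g_k'=g_kx^{q^k-1}$ for all $k$. Fine isomorphy invariant of $\phi$: put $I=\{i\in\{1,\dots,r\}: g_i\neq0\}$, $d=\gcd(q^k-1: k\in I)$ $(=q^{\delta}-1$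 with $\delta=\gcd(k:k\in I))$, and $B=\{\lambda=(\lambda_k)_{k\in I}\in\mathbb{Z}^I: d=\sum_{k\in I}\lambda_k(q^k-1)\}$. For $\lambda\in B$ let $FI_\lambda(\phi)$ be the class of $\prod_{k\in I}g_k^{\lambda_k}$ in $L^*/L^{*d}$, where $L^{*d}$ is the group of $d$-th powers in $L^*$. Then $FI(\phi)=(FI_\lambda(\phi))_{\lambda\in B}$. (When $\phi$ and $\psi$ are isomorphic over $L^{sep}$ they have the same $I$, $d$ and $B$.) *)

theory Defs
  imports "HOL-Computational_Algebra.Polynomial" "HOL-Library.FuncSet" "HOL-Library.Cardinality"
begin

definition is_ring_hom :: "('a::comm_ring_1 \<Rightarrow> 'b::comm_ring_1) \<Rightarrow> bool" where
  "is_ring_hom f \<longleftrightarrow>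
     f 1 = 1 \<and> (\<forall>x y. f (x + y) = f x + f y) \<and> (\<forall>x y. f (x * y) = f x * f y)"

text \<open>The field with \<open>q\<close> elements is a finite field type \<open>'k\<close>, so \<open>q = CARD('k)\<close> and
  \<open>A = 'k poly\<close>, with \<open>T = [:0, 1:]\<close>.  The map \<open>\<iota>\<close> is the structure map of the
  \<open>'k\<close>-algebra \<open>'l\<close>.\<close>

definition A_field :: "('k::{field,finite} \<Rightarrow> 'l::field) \<Rightarrow> ('k poly \<Rightarrow> 'l) \<Rightarrow> bool" where
  "A_field \<iota> \<gamma> \<longleftrightarrow> is_ring_hom \<iota> \<and> is_ring_hom \<gamma> \<and> (\<forall>c. \<gamma> [:c:] = \<iota> c)"

text \<open>\<open>L{\<tau>}\<close> as a set of ordinary polynomials: \<open>c \<tau>\<^sup>i\<close> is the polynomial \<open>monom c (q ^ i)\<close>.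
  Addition is that of polynomials, the product is composition (\<^const>\<open>pcompose\<close>), the unit is
  \<open>X = [:0, 1:]\<close>, and the scalar \<open>c \<in> L\<close> is \<open>c X = [:0, c:]\<close>.\<close>

definition tau_polys :: "nat \<Rightarrow> 'l::field poly set" where
  "tau_polys q = {\<Sum>i\<le>n. monom (a i) (q ^ i) | n a. True}"

definition drinfeld_module ::
  "('k::{field,finite} \<Rightarrow> 'l::field) \<Rightarrow> ('k poly \<Rightarrow> 'l) \<Rightarrow> nat \<Rightarrow> ('k poly \<Rightarrow> 'l poly) \<Rightarrow> bool"
where
  "drinfeld_module \<iota> \<gamma> r \<phi> \<longleftrightarrow>
     (\<forall>a. \<phi> a \<in> tau_polys CARD('k)) \<and>
     \<phi> 1 = [:0, 1:] \<and>
     (\<forall>a b. \<phi> (a + b) = \<phi> a + \<phi> b) \<and>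
     (\<forall>a b. \<phi> (a * b) = pcompose (\<phi> a) (\<phi> b)) \<and>
     (\<forall>c. \<phi> [:c:] = [:0, \<iota> c:]) \<and>
     r \<ge> 1 \<and>
     (\<exists>g. \<phi> [:0, 1:] = [:0, \<gamma> [:0, 1:]:] + (\<Sum>i=1..r. monom (g i) (CARD('k) ^ i)) \<and> g r \<noteq> 0)"

text \<open>\<open>drinfeld_coeff \<phi> i\<close> is the coefficient \<open>g\<^sub>i\<close> of \<open>\<tau>\<^sup>i\<close> in \<open>\<phi>\<^sub>T\<close>.\<close>

definition drinfeld_coeff :: "('k::{field,finite} poly \<Rightarrow> 'l::field poly) \<Rightarrow> nat \<Rightarrow> 'l" where
  "drinfeld_coeff \<phi> i = coeff (\<phi> [:0, 1:]) (CARD('k) ^ i)"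

text \<open>Isomorphy over the extension \<open>e : L \<rightarrow> K\<close>: \<open>\<psi>\<^sub>T = x\<inverse> \<phi>\<^sub>T x\<close> in \<open>K{\<tau>}\<close>.\<close>

definition isomorphic_over ::
  "('l::field \<Rightarrow> 'm::field) \<Rightarrow> ('k::{field,finite} poly \<Rightarrow> 'l poly) \<Rightarrow> ('k poly \<Rightarrow> 'l poly) \<Rightarrow> bool"
where
  "isomorphic_over e \<phi> \<psi> \<longleftrightarrow>
     (\<exists>x. x \<noteq> 0 \<and>
        map_poly e (\<psi> [:0, 1:]) =
          pcompose [:0, inverse x:] (pcompose (map_poly e (\<phi> [:0, 1:])) [:0, x:]))"

definition separable_poly :: "'a::field poly \<Rightarrow> bool" where
  "separable_poly p \<longleftrightarrow> coprime p (pderiv p)"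

text \<open>\<open>e\<close> exhibits \<open>'m\<close> as a separable closure of \<open>'l\<close>: the extension is algebraic and
  separable (the irreducible \<open>p\<close> is a minimal polynomial, up to a unit), and \<open>'m\<close> is separably
  closed.\<close>

definition is_separable_closure :: "('l::field \<Rightarrow> 'm::field) \<Rightarrow> bool" where
  "is_separable_closure e \<longleftrightarrow>
     is_ring_hom e \<and>
     (\<forall>x. \<exists>p. irreducible p \<and> separable_poly p \<and> poly (map_poly e p) x = 0) \<and>
     (\<forall>p :: 'm poly. degree p > 0 \<and> separable_poly p \<longrightarrow> (\<exists>x. poly p x = 0))"

definition inv_I :: "nat \<Rightarrow> ('k::{field,finite} poly \<Rightarrow> 'l::field poly) \<Rightarrow> nat set" where
  "inv_I r \<phi> = {i \<in> {1..r}. drinfeld_coeff \<phi> i \<noteq> 0}"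

definition inv_d :: "nat \<Rightarrow> ('k::{field,finite} poly \<Rightarrow> 'l::field poly) \<Rightarrow> nat" where
  "inv_d r \<phi> = Gcd ((\<lambda>k. CARD('k) ^ k - 1) ` inv_I r \<phi>)"

definition inv_B :: "nat \<Rightarrow> ('k::{field,finite} poly \<Rightarrow> 'l::field poly) \<Rightarrow> (nat \<Rightarrow> int) set" where
  "inv_B r \<phi> =
     {l \<in> inv_I r \<phi> \<rightarrow>\<^sub>E UNIV. int (inv_d r \<phi>) = (\<Sum>k\<in>inv_I r \<phi>. l k * (int CARD('k) ^ k - 1))}"

text \<open>The class of \<open>x \<in> L\<^sup>*\<close> in the quotient of \<open>L\<^sup>*\<close> by its \<open>d\<close>-th powers, as a coset.\<close>

definition power_class :: "nat \<Rightarrow> 'l::field \<Rightarrow> 'l set" where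
  "power_class d x = {x * u ^ d | u. u \<noteq> 0}"

definition FI_at ::
  "nat \<Rightarrow> ('k::{field,finite} poly \<Rightarrow> 'l::field poly) \<Rightarrow> (nat \<Rightarrow> int) \<Rightarrow> 'l set" where
  "FI_at r \<phi> l = power_class (inv_d r \<phi>) (\<Prod>k\<in>inv_I r \<phi>. drinfeld_coeff \<phi> k powi l k)"

definition FI ::
  "nat \<Rightarrow> ('k::{field,finite} poly \<Rightarrow> 'l::field poly) \<Rightarrow> (nat \<Rightarrow> int) \<Rightarrow> 'l set" where
  "FI r \<phi> = restrict (FI_at r \<phi>) (inv_B r \<phi>)"

end

(* Comparing coefficients, an isomorphism over K is an x in K^* with g'_k = g_k x^(q^k-1) for all k.
   Raising these equations to the powers lambda_k and multiplying them gives
   prod g'_k^lambda_k = x^d prod g_k^lambda_k.  Hence x in L preserves all invariants.  Conversely, if x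
   lies in L^sep and a single FI_lambda agrees, then x^d = u^d for some u in L^*; as d divides every
   q^k-1 with g_k nonzero, u is an isomorphism over L. *)

theory Submission
  imports Defs
begin

section \<open>Ring homomorphisms between fields\<close>

lemma is_ring_hom_diff:
  assumes "is_ring_hom f"
  shows "f (x - y) = f x - f y"
  using assms unfolding is_ring_hom_def by (metis add_diff_cancel diff_add_cancel)

lemma is_ring_hom_0:
  assumes "is_ring_hom f"
  shows "f 0 = 0"
  using is_ring_hom_diff[OF assms, of 0 0] by simp

lemma is_ring_hom_power:
  assumes "is_ring_hom f"
  shows "f (x ^ n) = f x ^ n"
  using assms unfolding is_ring_hom_def by (induction n) auto

lemma is_ring_hom_prod:
  assumes "is_ring_hom f"
  shows "f (prod h A) = (\<Prod>k\<in>A. f (h k))"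
  using assms unfolding is_ring_hom_def by (induction A rule: infinite_finite_induct) auto

lemma is_ring_hom_eq_0_iff:
  fixes f :: "'a::field \<Rightarrow> 'b::field"
  assumes "is_ring_hom f"
  shows "f x = 0 \<longleftrightarrow> x = 0"
proof
  assume "f x = 0"
  show "x = 0"
  proof (rule ccontr)
    assume "x \<noteq> 0"
    then have "f x * f (inverse x) = 1"
      using assms unfolding is_ring_hom_def by (metis right_inverse)
    with \<open>f x = 0\<close> show False by simp
  qed
qed (simp add: is_ring_hom_0[OF assms])

lemma is_ring_hom_eq_iff:
  fixes f :: "'a::field \<Rightarrow> 'b::field"
  assumes "is_ring_hom f"
  shows "f x = f y \<longleftrightarrow> x = y"
  using is_ring_hom_eq_0_iff[OF assms, of "x - y"] by (simp add: is_ring_hom_diff[OF assms])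

lemma is_ring_hom_inverse:
  fixes f :: "'a::field \<Rightarrow> 'b::field"
  assumes "is_ring_hom f"
  shows "f (inverse x) = inverse (f x)"
proof (cases "x = 0")
  case True
  then show ?thesis by (simp add: is_ring_hom_0[OF assms])
next
  case False
  then have "f x * f (inverse x) = 1"
    using assms unfolding is_ring_hom_def by (metis right_inverse)
  then show ?thesis by (metis inverse_unique)
qed

text \<open>Integer powers matter here because the exponents \<open>l k\<close> of the invariants
  may be negative; for those, compatibility with \<open>inverse\<close> is used.\<close>

lemma is_ring_hom_powi:
  fixes f :: "'a::field \<Rightarrow> 'b::field"
  assumes "is_ring_hom f"
  shows "f (x powi n) = f x powi n"
  by (simp add: power_int_def is_ring_hom_power[OF assms] is_ring_hom_inverse[OF assms])

lemma is_ring_hom_id: "is_ring_hom (\<lambda>x. x)"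
  by (simp add: is_ring_hom_def)

section \<open>Bezout coefficients: the index set B of the invariants\<close>

lemma Gcd_bezout_nat:
  fixes f :: "'a \<Rightarrow> nat"
  assumes "finite A"
  shows "\<exists>l. int (Gcd (f ` A)) = (\<Sum>k\<in>A. l k * int (f k))"
  using assms
proof (induction A rule: finite_induct)
  case empty
  then show ?case by simp
next
  case (insert a A)
  then obtain l where l: "int (Gcd (f ` A)) = (\<Sum>k\<in>A. l k * int (f k))" by blast
  obtain u v where "u * int (f a) + v * int (Gcd (f ` A)) = gcd (int (f a)) (int (Gcd (f ` A)))"
    using bezout_int by blast
  then have "int (Gcd (f ` insert a A)) = u * int (f a) + v * int (Gcd (f ` A))"
    by simp
  also have "\<dots> = u * int (f a) + (\<Sum>k\<in>A. v * l k * int (f k))"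
    by (simp add: l sum_distrib_left mult.assoc)
  \<comment> \<open>As \<open>a\<close> is not in \<open>A\<close>, setting the coefficient at
    \<open>a\<close> to \<open>u\<close> does not disturb the scaled old ones.\<close>
  also have "\<dots> = (\<Sum>k\<in>insert a A. (if k = a then u else v * l k) * int (f k))"
    using insert by (auto intro!: sum.cong)
  finally show ?case by (rule exI[of _ "\<lambda>k. if k = a then u else v * l k"])
qed

text \<open>Needed for (iii) to imply (ii): over an empty B, equality of the families
  \<open>FI\<close> would carry no information.\<close>

lemma inv_B_nonempty: "inv_B r \<phi> \<noteq> {}"
  for \<phi> :: "'k::{field,finite} poly \<Rightarrow> 'l::field poly"
proof -
  let ?I = "inv_I r \<phi>"
  have "finite ?I" by (simp add: inv_I_def)
  then obtain l where "int (inv_d r \<phi>) = (\<Sum>k\<in>?I. l k * int (CARD('k) ^ k - 1))"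
    unfolding inv_d_def using Gcd_bezout_nat by blast
  \<comment> \<open>Members of \<open>inv_B\<close> are extensional, hence \<open>restrict\<close>.
    Since q^k >= 1, subtraction of naturals agrees with that of integers.\<close>
  then have "restrict l ?I \<in> inv_B r \<phi>"
    by (simp add: inv_B_def of_nat_diff)
  then show ?thesis by blast
qed

section \<open>Isomorphisms in terms of coefficients\<close>

lemma CARD_field_gt_1: "CARD('k::{field,finite}) > 1"
proof -
  have "card {0, 1 :: 'k} \<le> CARD('k)" by (rule card_mono) auto
  then show ?thesis by simp
qed

text \<open>The term g_i \<tau>^i sits in degree q^i and the scalar \<gamma>(T) in degree 1. Thus
  two modules over the same \<gamma> can differ only in the degrees q^i with 1 <= i <= r.\<close>

lemma drinfeld_module_coeff:
  fixes \<phi> :: "'k::{field,finite} poly \<Rightarrow> 'l::field poly"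
  assumes "drinfeld_module \<iota> \<gamma> r \<phi>"
  shows "coeff (\<phi> [:0, 1:]) 1 = \<gamma> [:0, 1:]"
    and "n \<noteq> 1 \<Longrightarrow> n \<notin> (\<lambda>i. CARD('k) ^ i) ` {1..r} \<Longrightarrow> coeff (\<phi> [:0, 1:]) n = 0"
proof -
  obtain g where g: "\<phi> [:0, 1:] = [:0, \<gamma> [:0, 1:]:] + (\<Sum>i=1..r. monom (g i) (CARD('k) ^ i))"
    using assms unfolding drinfeld_module_def by blast
  have *: "coeff (\<phi> [:0, 1:]) n = (if n = 1 then \<gamma> [:0, 1:] else 0)"
    if "n \<notin> (\<lambda>i. CARD('k) ^ i) ` {1..r}" for n
  proof -
    have "(\<Sum>i=1..r. coeff (monom (g i) (CARD('k) ^ i)) n) = 0"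
      using that by (intro sum.neutral) auto
    then show ?thesis
      unfolding g by (simp add: coeff_sum coeff_pCons split: nat.splits)
  qed
  \<comment> \<open>As q > 1, no g_i contributes to the linear coefficient.\<close>
  have "1 \<notin> (\<lambda>i. CARD('k) ^ i) ` {1..r}"
  proof
    assume "1 \<in> (\<lambda>i. CARD('k) ^ i) ` {1..r}"
    then obtain i where "1 = CARD('k) ^ i" "i > 0" by auto
    with one_less_power[OF CARD_field_gt_1[where 'k='k], of i] show False by simp
  qed
  with * show "coeff (\<phi> [:0, 1:]) 1 = \<gamma> [:0, 1:]" by simp
  show "coeff (\<phi> [:0, 1:]) n = 0" if "n \<noteq> 1" "n \<notin> (\<lambda>i. CARD('k) ^ i) ` {1..r}"
    using *[OF that(2)] that(1) by simp
qed

text \<open>Conjugation by x scales the coefficient in degree n by x^(n-1). In degree 1 the factor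
  is 1 and both sides have \<gamma>(T); outside 1 and the q^k both sides vanish.\<close>

lemma isomorphic_over_iff_coeff:
  fixes \<phi> \<psi> :: "'k::{field,finite} poly \<Rightarrow> 'l::field poly"
  assumes "drinfeld_module \<iota> \<gamma> r \<phi>" "drinfeld_module \<iota> \<gamma> r \<psi>" "is_ring_hom e"
  shows "isomorphic_over e \<phi> \<psi> \<longleftrightarrow>
    (\<exists>x. x \<noteq> 0 \<and> (\<forall>k\<in>{1..r}.
       e (drinfeld_coeff \<psi> k) = e (drinfeld_coeff \<phi> k) * x ^ (CARD('k) ^ k - 1)))"
proof -
  let ?T = "[:0, 1:] :: 'k poly"
  have e0: "e 0 = 0" using assms(3) by (rule is_ring_hom_0)
  have "map_poly e (\<psi> ?T) = pcompose [:0, inverse x:] (pcompose (map_poly e (\<phi> ?T)) [:0, x:])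
    \<longleftrightarrow> (\<forall>k\<in>{1..r}. e (drinfeld_coeff \<psi> k) = e (drinfeld_coeff \<phi> k) * x ^ (CARD('k) ^ k - 1))"
    (is "?P \<longleftrightarrow> ?Q") if x: "x \<noteq> 0" for x
  proof -
    \<comment> \<open>The factor is kept as \<open>inverse x * x ^ n\<close>, which is also right
      for n = 0, where \<open>n - 1\<close> truncates.\<close>
    let ?R = "\<lambda>n. e (coeff (\<psi> ?T) n) = inverse x * (x ^ n * e (coeff (\<phi> ?T) n))"
    have "?P \<longleftrightarrow> (\<forall>n. ?R n)"
      by (simp add: poly_eq_iff coeff_map_poly e0 coeff_pcompose_linear pcompose_pCons)
    also have "\<dots> \<longleftrightarrow> (\<forall>k\<in>{1..r}. ?R (CARD('k) ^ k))"
    proof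
      assume R: "\<forall>k\<in>{1..r}. ?R (CARD('k) ^ k)"
      show "\<forall>n. ?R n"
      proof
        fix n
        consider "n = 1" | "n \<in> (\<lambda>i. CARD('k) ^ i) ` {1..r}"
          | "n \<noteq> 1" "n \<notin> (\<lambda>i. CARD('k) ^ i) ` {1..r}" by blast
        then show "?R n"
        proof cases
          case 1
          then show ?thesis
            using x drinfeld_module_coeff(1)[OF assms(1)] drinfeld_module_coeff(1)[OF assms(2)]
            by simp
        next
          case 2
          then show ?thesis using R by blast
        next
          case 3
          then show ?thesis
            using drinfeld_module_coeff(2)[OF assms(1)] drinfeld_module_coeff(2)[OF assms(2)]
            by (simp add: e0)
        qed
      qed
    qed blast
    also have "\<dots> \<longleftrightarrow> ?Q"
    proof -
      have "inverse x * (x ^ (CARD('k) ^ k) * a) = a * x ^ (CARD('k) ^ k - 1)" for a k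
        using x by (simp add: power_diff field_simps)
      then show ?thesis by (simp only: drinfeld_coeff_def)
    qed
    finally show ?thesis .
  qed
  then show ?thesis unfolding isomorphic_over_def by auto
qed

section \<open>Behaviour of the invariants under twisting by x\<close>

lemma prod_power_int_sum:
  fixes x :: "'a::field"
  assumes "x \<noteq> 0"
  shows "(\<Prod>k\<in>A. x powi h k) = x powi (\<Sum>k\<in>A. h k)"
  using assms by (induction A rule: infinite_finite_induct) (auto simp: power_int_add)

text \<open>The exponents of x add up to d by the definition of B. The families \<open>a\<close> and
  \<open>b\<close> take values in any field, so that this serves both in L and for images under
  \<open>e\<close>.\<close>

lemma inv_B_prod_twist:
  fixes \<phi> :: "'k::{field,finite} poly \<Rightarrow> 'l::field poly" and x :: "'m::field"
  assumes "l \<in> inv_B r \<phi>" "x \<noteq> 0"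
    and "\<And>k. k \<in> inv_I r \<phi> \<Longrightarrow> b k = a k * x ^ (CARD('k) ^ k - 1)"
  shows "(\<Prod>k\<in>inv_I r \<phi>. b k powi l k) = (\<Prod>k\<in>inv_I r \<phi>. a k powi l k) * x ^ inv_d r \<phi>"
proof -
  let ?I = "inv_I r \<phi>"
  have "b k powi l k = a k powi l k * x powi (l k * (int CARD('k) ^ k - 1))" if "k \<in> ?I" for k
  proof -
    have "x ^ (CARD('k) ^ k - 1) = x powi (int CARD('k) ^ k - 1)"
      using power_int_of_nat[of x "CARD('k) ^ k - 1"] by (simp add: of_nat_diff)
    then show ?thesis
      by (simp add: assms(3)[OF that] power_int_mult_distrib power_int_mult[symmetric] mult.commute)
  qed
  then have "(\<Prod>k\<in>?I. b k powi l k) = (\<Prod>k\<in>?I. a k powi l k) * x powi int (inv_d r \<phi>)"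
    using assms(1,2) by (simp add: prod.distrib prod_power_int_sum inv_B_def)
  then show ?thesis by simp
qed

text \<open>The factors x^(q^k-1) are units, so the same coefficients vanish. Since d and B depend
  on the module only through I, the invariants become comparable.\<close>

lemma inv_I_eq_if_twist:
  fixes \<phi> \<psi> :: "'k::{field,finite} poly \<Rightarrow> 'l::field poly" and e :: "'l \<Rightarrow> 'm::field"
  assumes "is_ring_hom e" "x \<noteq> 0"
    and "\<forall>k\<in>{1..r}. e (drinfeld_coeff \<psi> k) = e (drinfeld_coeff \<phi> k) * x ^ (CARD('k) ^ k - 1)"
  shows "inv_I r \<psi> = inv_I r \<phi>"
proof -
  have "drinfeld_coeff \<psi> k = 0 \<longleftrightarrow> drinfeld_coeff \<phi> k = 0" if "k \<in> {1..r}" for k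
    using assms(3)[rule_format, OF that] assms(2)
    by (simp flip: is_ring_hom_eq_0_iff[OF assms(1)])
  then show ?thesis by (auto simp: inv_I_def)
qed

text \<open>The substitutions u -> x u and u -> u / x give the two inclusions of cosets.\<close>

lemma power_class_mult_power:
  fixes x :: "'a::field"
  assumes "x \<noteq> 0"
  shows "power_class d (a * x ^ d) = power_class d a"
proof -
  have "\<exists>v. a * x ^ d * u ^ d = a * v ^ d \<and> v \<noteq> 0" if "u \<noteq> 0" for u
    using that assms by (intro exI[of _ "x * u"]) (simp add: power_mult_distrib)
  moreover have "\<exists>v. a * u ^ d = a * x ^ d * v ^ d \<and> v \<noteq> 0" if "u \<noteq> 0" for u
    using that assms by (intro exI[of _ "u / x"]) (simp add: power_divide)
  ultimately show ?thesis unfolding power_class_def by blast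
qed

lemma power_class_self: "a \<in> power_class d a"
  unfolding power_class_def by (rule CollectI, rule exI[of _ 1]) simp

section \<open>Passing from L to the extension, and descending back to L\<close>

lemma isomorphic_over_self_imp_FI:
  fixes \<phi> \<psi> :: "'k::{field,finite} poly \<Rightarrow> 'l::field poly"
  assumes "drinfeld_module \<iota> \<gamma> r \<phi>" "drinfeld_module \<iota> \<gamma> r \<psi>" "is_ring_hom e"
    and "isomorphic_over (\<lambda>x. x) \<phi> \<psi>"
  shows "isomorphic_over e \<phi> \<psi>" and "FI r \<phi> = FI r \<psi>"
proof -
  obtain x where x: "x \<noteq> 0"
    and tw: "\<forall>k\<in>{1..r}. drinfeld_coeff \<psi> k = drinfeld_coeff \<phi> k * x ^ (CARD('k) ^ k - 1)"
    using assms(4) isomorphic_over_iff_coeff[OF assms(1,2) is_ring_hom_id] by blast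
  have "\<forall>k\<in>{1..r}. e (drinfeld_coeff \<psi> k) = e (drinfeld_coeff \<phi> k) * e x ^ (CARD('k) ^ k - 1)"
    using tw assms(3) by (simp add: is_ring_hom_def flip: is_ring_hom_power[OF assms(3)])
  moreover have "e x \<noteq> 0" using x is_ring_hom_eq_0_iff[OF assms(3)] by blast
  ultimately show "isomorphic_over e \<phi> \<psi>"
    unfolding isomorphic_over_iff_coeff[OF assms(1-3)] by blast
  have I: "inv_I r \<psi> = inv_I r \<phi>" by (rule inv_I_eq_if_twist[OF is_ring_hom_id x tw])
  then have d: "inv_d r \<psi> = inv_d r \<phi>" and B: "inv_B r \<psi> = inv_B r \<phi>"
    by (simp_all add: inv_d_def inv_B_def)
  have "FI_at r \<psi> l = FI_at r \<phi> l" if "l \<in> inv_B r \<phi>" for l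
    unfolding FI_at_def I d
    \<comment> \<open>The two products differ by x^d with x in L, which the coset absorbs.\<close>
    by (subst inv_B_prod_twist[OF that x, where a = "drinfeld_coeff \<phi>"])
      (use tw in \<open>auto simp: inv_I_def power_class_mult_power[OF x]\<close>)
  then show "FI r \<phi> = FI r \<psi>" unfolding FI_def B by (intro restrict_ext) simp
qed

text \<open>The twisting element x lives in the extension and need not come from L; one matching
  invariant supplies a replacement u in L.\<close>

lemma isomorphic_over_self_if_FI_at:
  fixes \<phi> \<psi> :: "'k::{field,finite} poly \<Rightarrow> 'l::field poly"
  assumes "drinfeld_module \<iota> \<gamma> r \<phi>" "drinfeld_module \<iota> \<gamma> r \<psi>" "is_ring_hom e"
    and "isomorphic_over e \<phi> \<psi>" and l: "l \<in> inv_B r \<phi>" and FI: "FI_at r \<phi> l = FI_at r \<psi> l"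
  shows "isomorphic_over (\<lambda>x. x) \<phi> \<psi>"
proof -
  note e = assms(3)
  let ?I = "inv_I r \<phi>" and ?d = "inv_d r \<phi>"
  let ?P = "\<lambda>\<chi>. \<Prod>k\<in>?I. drinfeld_coeff \<chi> k powi l k"
  obtain x where x: "x \<noteq> 0" and tw: "\<forall>k\<in>{1..r}.
      e (drinfeld_coeff \<psi> k) = e (drinfeld_coeff \<phi> k) * x ^ (CARD('k) ^ k - 1)"
    using assms(4) unfolding isomorphic_over_iff_coeff[OF assms(1-3)] by blast
  have I: "inv_I r \<psi> = ?I" by (rule inv_I_eq_if_twist[OF e x tw])
  then have d: "inv_d r \<psi> = ?d" by (simp add: inv_d_def)
  have "?P \<psi> \<in> power_class ?d (?P \<phi>)"
    using FI power_class_self[of "?P \<psi>" ?d] by (simp add: FI_at_def I d)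
  then obtain u where u: "u \<noteq> 0" and Pu: "?P \<psi> = ?P \<phi> * u ^ ?d"
    unfolding power_class_def by blast
  have eP: "e (?P \<chi>) = (\<Prod>k\<in>?I. e (drinfeld_coeff \<chi> k) powi l k)" for \<chi>
    by (simp add: is_ring_hom_prod[OF e] is_ring_hom_powi[OF e])
  have "e (?P \<psi>) = e (?P \<phi>) * x ^ ?d"
    unfolding eP by (rule inv_B_prod_twist[OF l x]) (use tw in \<open>auto simp: inv_I_def\<close>)
  moreover have "e (?P \<psi>) = e (?P \<phi>) * e u ^ ?d"
    using e unfolding Pu by (simp add: is_ring_hom_def flip: is_ring_hom_power[OF e])
  \<comment> \<open>All factors are nonzero by the choice of I, so the two expressions for
    \<open>e (?P \<psi>)\<close> can be cancelled to compare x^d with (e u)^d.\<close>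
  moreover have "e (?P \<phi>) \<noteq> 0"
    unfolding is_ring_hom_eq_0_iff[OF e] by (simp add: inv_I_def)
  ultimately have xd: "x ^ ?d = e u ^ ?d" by simp
  have "drinfeld_coeff \<psi> k = drinfeld_coeff \<phi> k * u ^ (CARD('k) ^ k - 1)" if k: "k \<in> {1..r}" for k
  proof (cases "k \<in> ?I")
    case True
    then have "?d dvd CARD('k) ^ k - 1" by (simp add: inv_d_def)
    then obtain m where "CARD('k) ^ k - 1 = ?d * m" ..
    \<comment> \<open>Possibly x and \<open>e u\<close> differ by a d-th root of unity, but only the
      m-th power of x^d enters.\<close>
    then have "x ^ (CARD('k) ^ k - 1) = e (u ^ (CARD('k) ^ k - 1))"
      by (simp add: is_ring_hom_power[OF e] power_mult xd)
    then have "e (drinfeld_coeff \<psi> k) = e (drinfeld_coeff \<phi> k * u ^ (CARD('k) ^ k - 1))"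
      using tw k e by (simp add: is_ring_hom_def)
    then show ?thesis by (simp add: is_ring_hom_eq_iff[OF e])
  next
    \<comment> \<open>Outside I both coefficients are zero, so any u fits.\<close>
    case False
    then have "k \<notin> inv_I r \<psi>" by (simp add: I)
    with False k show ?thesis by (simp add: inv_I_def)
  qed
  with u show ?thesis
    unfolding isomorphic_over_iff_coeff[OF assms(1,2) is_ring_hom_id] by blast
qed

theorem theorem2p1:
  fixes \<iota> :: "'k::{field,finite} \<Rightarrow> 'l::{field,finite}"
    and \<gamma> :: "'k poly \<Rightarrow> 'l"
    and e :: "'l \<Rightarrow> 'lsep::field"
    and \<phi> \<psi> :: "'k poly \<Rightarrow> 'l poly"
    and r :: nat
  assumes "A_field \<iota> \<gamma>"
    and "is_separable_closure e"
    and "drinfeld_module \<iota> \<gamma> r \<phi>"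
    and "drinfeld_module \<iota> \<gamma> r \<psi>"
  shows "(isomorphic_over (\<lambda>x. x :: 'l) \<phi> \<psi> \<longleftrightarrow>
            isomorphic_over e \<phi> \<psi> \<and> (\<exists>l\<in>inv_B r \<phi>. FI_at r \<phi> l = FI_at r \<psi> l)) \<and>
         (isomorphic_over (\<lambda>x. x :: 'l) \<phi> \<psi> \<longleftrightarrow>
            isomorphic_over e \<phi> \<psi> \<and> FI r \<phi> = FI r \<psi>)"
proof -
  have e: "is_ring_hom e" using assms(2) by (simp add: is_separable_closure_def)
  have i_iii: "isomorphic_over e \<phi> \<psi> \<and> FI r \<phi> = FI r \<psi>" if "isomorphic_over (\<lambda>x. x) \<phi> \<psi>"
    using isomorphic_over_self_imp_FI[OF assms(3,4) e that] by blast
  have iii_ii: "\<exists>l\<in>inv_B r \<phi>. FI_at r \<phi> l = FI_at r \<psi> l"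
    if iso: "isomorphic_over e \<phi> \<psi>" and FI: "FI r \<phi> = FI r \<psi>"
  proof -
    obtain x where "x \<noteq> 0" "\<forall>k\<in>{1..r}.
        e (drinfeld_coeff \<psi> k) = e (drinfeld_coeff \<phi> k) * x ^ (CARD('k) ^ k - 1)"
      using iso unfolding isomorphic_over_iff_coeff[OF assms(3,4) e] by blast
    then have "inv_I r \<psi> = inv_I r \<phi>" by (rule inv_I_eq_if_twist[OF e])
    \<comment> \<open>\<open>FI\<close> is restricted to the index set of its own module; evaluating
      \<open>FI r \<phi> = FI r \<psi>\<close> at \<open>l\<close> yields the \<open>FI_at\<close>
      values only once both index sets contain \<open>l\<close>.\<close>
    then have B: "inv_B r \<psi> = inv_B r \<phi>" by (simp add: inv_d_def inv_B_def)
    obtain l where l: "l \<in> inv_B r \<phi>" using inv_B_nonempty by blast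
    with fun_cong[OF FI, of l] show ?thesis by (auto simp: FI_def B)
  qed
  have ii_i: "isomorphic_over (\<lambda>x. x) \<phi> \<psi>"
    if "isomorphic_over e \<phi> \<psi>" "\<exists>l\<in>inv_B r \<phi>. FI_at r \<phi> l = FI_at r \<psi> l"
    using that isomorphic_over_self_if_FI_at[OF assms(3,4) e] by blast
  show ?thesis using i_iii iii_ii ii_i by blast
qed

end
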